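(* Let $m\ge 1$ be an integer. Define polynomials $P_k^{(m)}(x)\in\mathbb{Z}[x]$, $k\ge 0$, by the expansion in $\mathbb{Z}[x][[y]]$ $$\sum_{k=0}^\infty P_k^{(m)}(x)\,y^k=\frac{1+(x-1)y}{1-y+x(1-x)^m y^{m+1}},$$ and set $P_k^{(m)}=0$ for $k<0$. For each integer $k\ge 0$ let $F_k^+(x)=\sum_{n=0}^\infty\binom{n}{k}_m x^n$ and $F_k^-(x)=\sum_{n=1}^\infty\binom{-n}{k}_m x^n$ (formal power series in $x$). Then $$F_k^+(x)=\left(\frac{1}{1-x}\right)^{k+1}P_k^{(m)}(x),\qquad F_k^-(x)=(-1)^k\left(\frac{x}{1-x}\right)^{k+1}P_k^{(m)}(x^{-1}).$$ Moreover $P_0^{(m)}(x)=1$, $P_1^{(m)}(x)=x$, the polynomials satisfy $P_k^{(m)}(x)=P_{k-1}^{(m)}(x)-x(1-x)^mP_{k-m-1}^{(m)}(x)$ for all $k\ge 2$, and $P_k^{(m)}(x)=x$ for all $1\le k\le m$.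
   Context: For an integer $m\ge 1$ let $p_m(t)=1+t+\cdots+t^m$. For $n\in\mathbb{Z}$ and integer $k\ge 0$, $\binom{n}{k}_m$ denotes the coefficient of $t^k$ in the formal power series $p_m(t)^n\in\mathbb{Z}[[t]]$ (for $n<0$, the expansion of $1/p_m(t)^{-n}$), and $\binom{n}{k}_m=0$ for $k<0$. Note $\deg P_k^{(m)}\le k$, so $x^{k+1}P_k^{(m)}(x^{-1})$ is a polynomial. *)

theory Defs
  imports "HOL-Computational_Algebra.Formal_Laurent_Series"
begin

(* The library's division and inverse on power series need coefficients in a type of class
   inverse, which int and int poly are not.  For a series with constant term 1 over a
   commutative ring this is the inverse 1 / f; it is only used for such series. *)
definition recip :: "'a::comm_ring_1 fps \<Rightarrow> 'a fps" where
  "recip f = fps_right_inverse f 1"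

lemma mult_recip: "f $ 0 = 1 \<Longrightarrow> f * recip f = 1"
  for f :: "'a::comm_ring_1 fps"
  unfolding recip_def by (rule fps_right_inverse) simp

lemma recip_unique:
  fixes f g :: "'a::comm_ring_1 fps"
  assumes "f $ 0 = 1" "f * g = 1"
  shows "g = recip f"
proof -
  have "g = g * (f * recip f)"
    using mult_recip[OF assms(1)] by simp
  also have "\<dots> = (f * g) * recip f"
    by (simp add: mult_ac)
  finally show ?thesis
    using assms(2) by simp
qed

definition p_series :: "nat \<Rightarrow> int fps" where
  "p_series m = (\<Sum>i\<le>m. fps_X ^ i)"

lemma p_series_nth_0: "p_series m $ 0 = 1"
  by (simp add: p_series_def fps_sum_nth)

definition p_series_powi :: "nat \<Rightarrow> int \<Rightarrow> int fps" where
  "p_series_powi m n =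
     (if 0 \<le> n then p_series m ^ nat n else recip (p_series m ^ nat (- n)))"

definition binom_m :: "nat \<Rightarrow> int \<Rightarrow> int \<Rightarrow> int" where
  "binom_m m n k = (if k < 0 then 0 else p_series_powi m n $ nat k)"

definition F_plus :: "nat \<Rightarrow> nat \<Rightarrow> int fps" where
  "F_plus m k = Abs_fps (\<lambda>n. binom_m m (int n) (int k))"

definition F_minus :: "nat \<Rightarrow> nat \<Rightarrow> int fps" where
  "F_minus m k = Abs_fps (\<lambda>n. if n = 0 then 0 else binom_m m (- int n) (int k))"

(* In the type int poly fps, the variable x is the polynomial [:0, 1:] and y is fps_X. *)
definition P_num :: "int poly fps" where
  "P_num = 1 + fps_const ([:0, 1:] - 1) * fps_X"

definition P_den :: "nat \<Rightarrow> int poly fps" where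
  "P_den m = 1 - fps_X + fps_const ([:0, 1:] * (1 - [:0, 1:]) ^ m) * fps_X ^ (m + 1)"

lemma P_den_nth_0: "P_den m $ 0 = 1"
  by (simp add: P_den_def)

definition P_poly :: "nat \<Rightarrow> int \<Rightarrow> int poly" where
  "P_poly m k = (if k < 0 then 0 else (P_num * recip (P_den m)) $ nat k)"

(* P(x^(-1)) as a formal Laurent series in x. *)
definition poly_at_X_inv :: "int poly \<Rightarrow> int fls" where
  "poly_at_X_inv P = poly (map_poly of_int P) fls_X_inv"

end

theory Submission
  imports Defs
begin

text \<open>
  Put \<open>A\<^sub>k = F\<^sub>k\<^sup>+\<close>, \<open>\<xi> = x\<close> or \<open>A\<^sub>k = -F\<^sub>k\<^sup>-\<close>, \<open>\<xi> = x\<^sup>-\<^sup>1\<close>.  Comparing coefficients of \<open>t\<^sup>k\<close> in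
  \<open>(1 - t) p\<^sub>m(t)\<^sup>n\<^sup>+\<^sup>1 = (1 - t\<^sup>m\<^sup>+\<^sup>1) p\<^sub>m(t)\<^sup>n\<close> and summing over \<open>n\<close> gives the same recurrence in both
  cases: \<open>(1 - \<xi>) A\<^sub>k = A\<^sub>k\<^sub>-\<^sub>1 - \<xi> A\<^sub>k\<^sub>-\<^sub>m\<^sub>-\<^sub>1\<close>, up to an inhomogeneous term for \<open>k \<le> 1\<close>.  By the recurrence
  for the polynomials it is solved by \<open>P\<^sub>k(\<xi>) / (1 - \<xi>)\<^sup>k\<^sup>+\<^sup>1\<close>, and \<open>1 / (1 - x\<^sup>-\<^sup>1) = -x / (1 - x)\<close>.
\<close>

section \<open>The polynomials \<open>P_poly\<close> and the recurrence they solve\<close>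

lemma P_poly_neg: "k < 0 \<Longrightarrow> P_poly m k = 0"
  by (simp add: P_poly_def)

text \<open>Compare coefficients of y^k in \<open>P_den m * G = P_num\<close>, where
  \<open>G\<close> is the generating series. The last summand is the coefficient of
  \<open>P_num\<close>; keeping it makes the recurrence valid from k = 0 on.\<close>

lemma P_poly_rec:
  assumes "0 \<le> k"
  shows "P_poly m k = P_poly m (k - 1)
           - [:0, 1:] * (1 - [:0, 1:]) ^ m * P_poly m (k - int m - 1)
           + (if k = 0 then 1 else if k = 1 then [:0, 1:] - 1 else 0)"
proof -
  obtain j where j: "k = int j"
    using assms nonneg_int_cases by blast
  define G where "G = P_num * recip (P_den m)"
  define c :: "int poly" where "c = [:0, 1:] * (1 - [:0, 1:]) ^ m"
  have "P_den m * G = P_num * (P_den m * recip (P_den m))"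
    by (simp add: G_def mult_ac)
  also have "\<dots> = P_num"
    by (simp add: mult_recip[OF P_den_nth_0])
  finally have "G - fps_X * G + fps_const c * (fps_X ^ (m + 1) * G) = P_num"
    by (simp add: P_den_def c_def algebra_simps)
  then have "(G - fps_X * G + fps_const c * (fps_X ^ (m + 1) * G)) $ j = P_num $ j"
    by simp
  then have "G $ j - (if j = 0 then 0 else G $ (j - 1))
      + c * (if j < m + 1 then 0 else G $ (j - (m + 1))) = P_num $ j"
    by (simp only: fps_add_nth fps_sub_nth fps_X_mult_nth fps_mult_left_const_nth
        fps_X_power_mult_nth)
  moreover have "P_poly m k = G $ j"
    by (simp add: P_poly_def j G_def)
  moreover have "P_poly m (k - 1) = (if j = 0 then 0 else G $ (j - 1))"
    by (simp add: P_poly_def j G_def nat_diff_distrib)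
  moreover have "P_poly m (k - int m - 1) = (if j < m + 1 then 0 else G $ (j - (m + 1)))"
  proof (cases "j < m + 1")
    case False
    then have "nat (k - int m - 1) = j - (m + 1)"
      by (simp add: j)
    with False show ?thesis
      by (simp add: P_poly_def G_def j)
  qed (simp add: P_poly_def j)
  moreover have "P_num $ j = (if k = 0 then 1 else if k = 1 then [:0, 1:] - 1 else 0)"
    by (simp add: P_num_def j)
  ultimately show ?thesis
    unfolding c_def[symmetric] by (simp add: algebra_simps)
qed

lemma P_poly_0: "P_poly m 0 = 1"
  using P_poly_rec[of 0 m] by (simp add: P_poly_neg)

text \<open>At k = 1 the recurrence gives 1 + (x - 1). Up to k = m the index k - m - 1 stays
  negative, so the value does not change.\<close>

lemma P_poly_eq_X: "1 \<le> k \<Longrightarrow> k \<le> int m \<Longrightarrow> P_poly m k = [:0, 1:]"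
proof (induction k rule: int_ge_induct)
  case base
  then show ?case
    using P_poly_rec[of 1 m] by (simp add: P_poly_neg P_poly_0)
next
  case (step k)
  then show ?case
    using P_poly_rec[of "k + 1" m] by (simp add: P_poly_neg)
qed

text \<open>Here \<open>\<phi>\<close> stands for evaluation at \<open>\<xi>\<close>. It is abstract
  so that one induction serves both \<open>fps_of_poly\<close> and
  \<open>poly_at_X_inv\<close>.\<close>

lemma recurrence_solution:
  fixes \<xi> w :: "'a::comm_ring_1" and \<phi> :: "int poly \<Rightarrow> 'a" and A :: "int \<Rightarrow> 'a"
  assumes hom: "\<phi> 1 = 1" "\<phi> [:0, 1:] = \<xi>"
      "\<And>p q. \<phi> (p + q) = \<phi> p + \<phi> q" "\<And>p q. \<phi> (p * q) = \<phi> p * \<phi> q"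
    and w: "w * (1 - \<xi>) = 1"
    and A_neg: "\<And>k. k < 0 \<Longrightarrow> A k = 0"
    and A_rec: "\<And>k. 0 \<le> k \<Longrightarrow> (1 - \<xi>) * A k = A (k - 1) - \<xi> * A (k - int m - 1)
                  + (if k = 0 then 1 else if k = 1 then -1 else 0)"
  shows "A (int k) = w ^ (k + 1) * \<phi> (P_poly m (int k))"
proof (induction k rule: less_induct)
  case (less k)
  have \<phi>_0: "\<phi> 0 = 0"
    using hom(3)[of 0 0] by simp
  have \<phi>_diff: "\<phi> (p - q) = \<phi> p - \<phi> q" for p q
    using hom(3)[of "p - q" q] by simp
  have \<phi>_power: "\<phi> (p ^ n) = \<phi> p ^ n" for p n
    by (induction n) (simp_all add: hom)
  define r where "r = (if k = 0 then 1 else if k = 1 then -1 else (0::'a))"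
  define s where "s = (if k = 0 then 1 else if k = 1 then \<xi> - 1 else (0::'a))"
  \<comment> \<open>The inhomogeneous terms of the two recurrences match: for k = 1, w^2 (\<xi> - 1)
    = -w.\<close>
  have r_s: "w * r = w ^ (k + 1) * s"
  proof (cases "k = 1")
    case True
    have "w ^ (k + 1) * s = - (w * (w * (1 - \<xi>)))"
      by (simp add: True s_def algebra_simps)
    with True w show ?thesis
      by (simp add: r_def)
  qed (simp add: r_def s_def)
  have prev: "A (int k - 1) = w ^ k * \<phi> (P_poly m (int k - 1))"
  proof (cases k)
    case (Suc j)
    then show ?thesis
      using less.IH[of j] by simp
  qed (simp add: A_neg P_poly_neg \<phi>_0)
  \<comment> \<open>The induction hypothesis supplies w^(k-m) only. Writing it as w^k (1 - \<xi>)^m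
    produces the factor (1 - x)^m of the polynomial recurrence.\<close>
  have lag: "A (int k - int m - 1) = w ^ k * (1 - \<xi>) ^ m * \<phi> (P_poly m (int k - int m - 1))"
  proof (cases "k < m + 1")
    case False
    define j where "j = k - m - 1"
    from False have j: "j < k" "k = j + 1 + m" "int k - int m - 1 = int j"
      by (auto simp: j_def)
    have "w ^ k * (1 - \<xi>) ^ m = w ^ (j + 1) * (w * (1 - \<xi>)) ^ m"
      by (simp add: j(2) power_add power_mult_distrib mult_ac)
    then show ?thesis
      using less.IH[OF j(1)] w j(3) by simp
  qed (simp add: A_neg P_poly_neg \<phi>_0)
  have "A (int k) = w * ((1 - \<xi>) * A (int k))"
    using w by (simp flip: mult.assoc)
  also have "(1 - \<xi>) * A (int k) = A (int k - 1) - \<xi> * A (int k - int m - 1) + r"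
    using A_rec[of "int k"] by (simp add: r_def)
  also have "w * \<dots> = w * (A (int k - 1) - \<xi> * A (int k - int m - 1)) + w * r"
    by (rule distrib_left)
  also have "\<dots> = w ^ (k + 1) * (\<phi> (P_poly m (int k - 1))
      - \<xi> * (1 - \<xi>) ^ m * \<phi> (P_poly m (int k - int m - 1)) + s)"
    unfolding prev lag r_s by (simp add: algebra_simps)
  also have "\<phi> (P_poly m (int k - 1))
      - \<xi> * (1 - \<xi>) ^ m * \<phi> (P_poly m (int k - int m - 1)) + s = \<phi> (P_poly m (int k))"
    \<comment> \<open>The third occurrence is the one on the right-hand side. Without
      \<open>mult_pCons_left\<close> the products with \<open>[:0, 1:]\<close> stay intact, so
      multiplicativity of \<open>\<phi>\<close> applies.\<close>
    by (subst (3) P_poly_rec) (simp_all add: hom \<phi>_0 \<phi>_diff \<phi>_power s_def del: mult_pCons_left)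
  finally show ?case .
qed

section \<open>Integer powers of p_m and their coefficients\<close>

lemma p_series_powi_add_1: "p_series_powi m (n + 1) = p_series m * p_series_powi m n"
proof (cases "0 \<le> n")
  case True
  then show ?thesis
    by (simp add: p_series_powi_def nat_add_distrib)
next
  case False
  define i where "i = nat (- (n + 1))"
  define p where "p = p_series m"
  have p0: "(p ^ j) $ 0 = 1" for j
    by (induction j) (simp_all add: p_def p_series_nth_0)
  have i: "nat (- n) = Suc i"
    using False by (simp add: i_def)
  \<comment> \<open>Here n = -(i + 1), so the claim is that p / p^(i+1) is the inverse of
    p^i.\<close>
  have "p ^ i * (p * recip (p ^ Suc i)) = 1"
    using mult_recip[OF p0[of "Suc i"]] by (simp add: mult_ac)
  then have "p * recip (p ^ Suc i) = recip (p ^ i)"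
    by (rule recip_unique[OF p0])
  moreover have "p_series_powi m (n + 1) = recip (p ^ i)"
  \<comment> \<open>At n = -1 the exponent n + 1 = 0 falls under the nonnegative branch of
    \<open>p_series_powi\<close>.\<close>
  proof (cases "n = -1")
    case True
    have "1 = recip (1 :: int fps)"
      by (rule recip_unique) simp_all
    with True show ?thesis
      by (simp add: p_series_powi_def i_def)
  qed (use False in \<open>simp add: p_series_powi_def i_def p_def\<close>)
  ultimately show ?thesis
    using False by (simp add: p_series_powi_def i p_def)
qed

text \<open>The exponent n ranges over all integers, so that both F^+ and F^- can draw on
  it.\<close>

lemma binom_m_rec:
  "binom_m m (n + 1) k - binom_m m (n + 1) (k - 1) = binom_m m n k - binom_m m n (k - int m - 1)"
proof (cases "k < 0")
  case False
  then obtain j where j: "k = int j"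
    using nonneg_int_cases linorder_not_less by metis
  define f where "f = p_series_powi m n"
  define g where "g = p_series_powi m (n + 1)"
  have "(1 - fps_X) * p_series m = 1 - fps_X ^ (m + 1)"
    by (simp only: p_series_def sum_gp_basic Suc_eq_plus1)
  then have "(1 - fps_X) * g = (1 - fps_X ^ (m + 1)) * f"
    by (simp only: f_def g_def p_series_powi_add_1 flip: mult.assoc)
  then have "(g - fps_X * g) $ j = (f - fps_X ^ (m + 1) * f) $ j"
    by (simp only: left_diff_distrib mult_1)
  then have "g $ j - (if j = 0 then 0 else g $ (j - 1))
      = f $ j - (if j < m + 1 then 0 else f $ (j - (m + 1)))"
    by (simp only: fps_sub_nth fps_X_mult_nth fps_X_power_mult_nth)
  moreover have "binom_m m (n + 1) (k - 1) = (if j = 0 then 0 else g $ (j - 1))"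
    by (simp add: binom_m_def j g_def nat_diff_distrib)
  moreover have "binom_m m n (k - int m - 1) = (if j < m + 1 then 0 else f $ (j - (m + 1)))"
  proof (cases "j < m + 1")
    case False
    then have "nat (k - int m - 1) = j - (m + 1)"
      by (simp add: j)
    with False show ?thesis
      by (simp add: binom_m_def f_def j)
  qed (simp add: binom_m_def j)
  ultimately show ?thesis
    by (simp add: binom_m_def j f_def g_def)
qed (simp add: binom_m_def)

lemma binom_m_0: "binom_m m 0 k = (if k = 0 then 1 else 0)"
  by (simp add: binom_m_def p_series_powi_def)

section \<open>The two generating functions\<close>

lemma recip_one_minus_X: "recip (1 - fps_X) * (1 - fps_X) = (1 :: int fps)"
  by (subst mult.commute, rule mult_recip) simp

lemma F_plus_eq:
  assumes "m \<ge> 1"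
  shows "F_plus m k = recip (1 - fps_X) ^ (k + 1) * fps_of_poly (P_poly m (int k))"
proof -
  \<comment> \<open>The index now runs over all integers, as the recurrence reaches below 0.\<close>
  define A where "A k = Abs_fps (\<lambda>n. binom_m m (int n) k)" for k
  have "A (int k) = recip (1 - fps_X) ^ (k + 1) * fps_of_poly (P_poly m (int k))"
  proof (rule recurrence_solution[where \<xi> = fps_X])
    show "A k = 0" if "k < 0" for k
      using that by (simp add: A_def binom_m_def fps_eq_iff)
    show "(1 - fps_X) * A k = A (k - 1) - fps_X * A (k - int m - 1)
        + (if k = 0 then 1 else if k = 1 then - 1 else 0)" if "0 \<le> k" for k
    proof (rule fps_ext)
      fix n
      show "((1 - fps_X) * A k) $ n = (A (k - 1) - fps_X * A (k - int m - 1)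
          + (if k = 0 then 1 else if k = 1 then - 1 else 0)) $ n"
      \<comment> \<open>The inhomogeneous term lives in the constant coefficient, where
        \<open>binom_m_0\<close> gives the values; all other coefficients are
        \<open>binom_m_rec\<close>.\<close>
      proof (cases n)
        case 0
        then show ?thesis
          using that assms by (auto simp: A_def algebra_simps binom_m_0)
      next
        case (Suc i)
        then show ?thesis
          using binom_m_rec[of m "int i" k] by (auto simp: A_def algebra_simps)
      qed
    qed
  qed (simp_all add: fps_of_poly_add fps_of_poly_mult recip_one_minus_X)
  then show ?thesis
    by (simp add: A_def F_plus_def)
qed

lemma map_poly_of_int_add:
  "map_poly of_int (p + q) = map_poly of_int p + (map_poly of_int q :: 'a::comm_ring_1 poly)"
  by (intro poly_eqI) (simp add: coeff_map_poly)

lemma map_poly_of_int_mult: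
  "map_poly of_int (p * q) = map_poly of_int p * (map_poly of_int q :: 'a::comm_ring_1 poly)"
  by (intro poly_eqI) (simp add: coeff_map_poly coeff_mult)

lemma F_minus_eq:
  assumes "m \<ge> 1"
  shows "fps_to_fls (F_minus m k) =
    (-1) ^ k * fps_to_fls (fps_X * recip (1 - fps_X)) ^ (k + 1) * poly_at_X_inv (P_poly m (int k))"
proof -
  define H where "H k = Abs_fps (\<lambda>n. if n = 0 then 0 else binom_m m (- int n) k)" for k
  define v where "v = fps_to_fls (fps_X * recip (1 - fps_X) :: int fps)"
  have X_inv: "fls_X_inv * fls_X = (1 :: int fls)"
    by (simp add: fls_X_inv_times_conv_shift)
  have v: "- v * (1 - fls_X_inv) = 1"
  proof -
    have "- v * (1 - fls_X_inv)
        = fps_to_fls (recip (1 - fps_X)) * (fls_X_inv * fls_X - fls_X)"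
      by (simp add: v_def fls_times_fps_to_fls algebra_simps)
    also have "\<dots> = fps_to_fls (recip (1 - fps_X) * (1 - fps_X))"
      by (simp add: X_inv fls_times_fps_to_fls)
    finally show ?thesis
      by (simp add: recip_one_minus_X)
  qed
  have "- fps_to_fls (H (int k)) = (- v) ^ (k + 1) * poly_at_X_inv (P_poly m (int k))"
  proof (rule recurrence_solution[where \<xi> = fls_X_inv and A = "\<lambda>k. - fps_to_fls (H k)"])
    show "- fps_to_fls (H k) = 0" if "k < 0" for k
      using that by (simp add: H_def binom_m_def fps_eq_iff)
    show "(1 - fls_X_inv) * - fps_to_fls (H k)
        = - fps_to_fls (H (k - 1)) - fls_X_inv * - fps_to_fls (H (k - int m - 1))
          + (if k = 0 then 1 else if k = 1 then - 1 else 0)" if "0 \<le> k" for k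
    proof -
      define r :: "int fps" where "r = (if k = 0 then 1 else if k = 1 then - 1 else 0)"
      \<comment> \<open>This is the required recurrence multiplied by x, which can be checked among
        power series; multiplying by \<open>fls_X_inv\<close> then restores it.\<close>
      have rec: "H k = fps_X * H k - fps_X * H (k - 1) + H (k - int m - 1) + fps_X * r"
      proof (rule fps_ext)
        fix n
        show "H k $ n = (fps_X * H k - fps_X * H (k - 1) + H (k - int m - 1) + fps_X * r) $ n"
        proof (cases n)
          case 0
          then show ?thesis
            by (simp add: H_def)
        next
          case (Suc i)
          then show ?thesis
            using binom_m_rec[of m "- int (Suc i)" k] that assms
            \<comment> \<open>For i = 0 the identity involves exponent 0, which the sum over n \<ge>
              1 omits; the missing terms, [k = 0] - [k = 1], are \<open>r\<close>.\<close>
            by (cases "i = 0") (auto simp: H_def r_def algebra_simps binom_m_0)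
        qed
      qed
      have "fls_X_inv * fps_to_fls (H k)
          = fls_X_inv * fps_to_fls (fps_X * H k - fps_X * H (k - 1) + H (k - int m - 1) + fps_X * r)"
        using rec by simp
      also have "\<dots> = (fls_X_inv * fls_X)
            * (fps_to_fls (H k) - fps_to_fls (H (k - 1)) + fps_to_fls r)
          + fls_X_inv * fps_to_fls (H (k - int m - 1))"
        by (simp add: fls_times_fps_to_fls algebra_simps)
      finally have "fls_X_inv * fps_to_fls (H k)
          = fps_to_fls (H k) - fps_to_fls (H (k - 1)) + fps_to_fls r
          + fls_X_inv * fps_to_fls (H (k - int m - 1))"
        by (simp add: X_inv)
      moreover have "fps_to_fls r = (if k = 0 then 1 else if k = 1 then - 1 else 0)"
        by (simp add: r_def)
      ultimately show ?thesis
        by (simp add: algebra_simps)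
    qed
  qed (use v in \<open>simp_all add: poly_at_X_inv_def map_poly_of_int_add map_poly_of_int_mult map_poly_pCons\<close>)
  \<comment> \<open>The sign of A = -F^- and the k + 1 signs of \<open>(- v) ^ (k + 1)\<close>
    combine to (-1)^k.\<close>
  then have "fps_to_fls (F_minus m k) = - ((- v) ^ (k + 1)) * poly_at_X_inv (P_poly m (int k))"
    by (simp add: H_def F_minus_def minus_equation_iff)
  then show ?thesis
    by (simp add: v_def[symmetric] power_minus[of v])
qed

theorem mainTheorem2:
  fixes m :: nat
  assumes "m \<ge> 1"
  shows
    "(\<forall>k::nat.
        F_plus m k = recip (1 - fps_X) ^ (k + 1) * fps_of_poly (P_poly m (int k))) \<and>
     (\<forall>k::nat.
        fps_to_fls (F_minus m k) =
          (-1) ^ k * fps_to_fls (fps_X * recip (1 - fps_X)) ^ (k + 1)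
            * poly_at_X_inv (P_poly m (int k))) \<and>
     P_poly m 0 = 1 \<and>
     P_poly m 1 = [:0, 1:] \<and>
     (\<forall>k::int. k \<ge> 2 \<longrightarrow>
        P_poly m k =
          P_poly m (k - 1) - [:0, 1:] * (1 - [:0, 1:]) ^ m * P_poly m (k - int m - 1)) \<and>
     (\<forall>k::int. 1 \<le> k \<and> k \<le> int m \<longrightarrow> P_poly m k = [:0, 1:])"
proof (intro conjI allI impI)
  \<comment> \<open>From k = 2 on the inhomogeneous term vanishes, as \<open>P_num\<close> has
    degree 1 in y.\<close>
  fix k :: int
  assume "k \<ge> 2"
  then show "P_poly m k =
      P_poly m (k - 1) - [:0, 1:] * (1 - [:0, 1:]) ^ m * P_poly m (k - int m - 1)"
    using P_poly_rec[of k m] by simp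
qed (use assms F_plus_eq F_minus_eq P_poly_0 P_poly_eq_X in auto)

end
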